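(* Let $a:\mathbb{Z}_{\ge 1}\to\mathbb{C}$ be an arithmetic function whose Dirichlet series $F_a(s)=\sum_{k=1}^{\infty} a(k)k^{-s}$ converges for some complex $s$. Then for every positive integer $n$, $$a(n)=-2\sum_{i=0}^{\infty}(-1)^i(2\pi n)^{2i}\sum_{j=0}^{i}\frac{(-1)^j(2\pi)^{-2j}F_a(2j)}{(2i+1-2j)!},$$ where, for those (finitely many) integers $j\ge 0$ for which the series $\sum_{k} a(k)k^{-2j}$ does not converge, $F_a(2j)$ is either taken to be the (finite) value at $2j$ of an analytic continuation of $F_a$, or the corresponding term of the inner sum is omitted (one fixed choice being made for each such $j$, for all $i$).
   Context: For $j$ such that $\sum_k a(k)k^{-2j}$ converges, $F_a(2j)$ denotes the sum of that series. The outer series over $i$ is summed in order of increasing $i$, each summand being the finite inner sum times $(-1)^i(2\pi n)^{2i}$; an inner sum with no remaining terms is $0$. *)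

theory Defs
  imports "HOL-Complex_Analysis.Complex_Analysis"
begin

text \<open>
  An arithmetic function is a function on \<^typ>\<open>nat\<close> whose value at \<open>0\<close> is ignored: the
  Dirichlet series runs over \<open>k \<ge> 1\<close>, and it is summed (possibly only conditionally) in order
  of increasing \<open>k\<close>.
\<close>

definition dirichlet_converges :: "(nat \<Rightarrow> complex) \<Rightarrow> complex \<Rightarrow> bool" where
  "dirichlet_converges a s \<longleftrightarrow> summable (\<lambda>k. a (Suc k) * of_nat (Suc k) powr (- s))"

definition dirichlet_series :: "(nat \<Rightarrow> complex) \<Rightarrow> complex \<Rightarrow> complex" where
  "dirichlet_series a s = (\<Sum>k. a (Suc k) * of_nat (Suc k) powr (- s))"

text \<open>
  The open half-plane to the right of the abscissa of convergence. The two descriptions agree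
  because convergence at \<open>w\<close> implies convergence at every \<open>s\<close> with \<open>Re s > Re w\<close>.
\<close>

definition convergence_half_plane :: "(nat \<Rightarrow> complex) \<Rightarrow> complex set" where
  "convergence_half_plane a = {s. \<exists>w. dirichlet_converges a w \<and> Re w < Re s}"

definition analytic_continuation ::
  "(nat \<Rightarrow> complex) \<Rightarrow> complex set \<Rightarrow> (complex \<Rightarrow> complex) \<Rightarrow> bool" where
  "analytic_continuation a D G \<longleftrightarrow>
     open D \<and> connected D \<and> convergence_half_plane a \<subseteq> D \<and> G holomorphic_on D \<and>
     (\<forall>s\<in>convergence_half_plane a. G s = dirichlet_series a s)"

end

theory Submission
  imports Defs
begin

text \<open>
  With \<open>x = 2\<pi>n\<close>, the summand of index \<open>i\<close> is the Cauchy product coefficient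
  \<open>\<Sum>j\<le>i. n\<^sup>2\<^sup>j F(2j) c(i-j)\<close>, where \<open>c(m) = (-1)\<^sup>m x\<^sup>2\<^sup>m / (2m+1)!\<close> and \<open>\<Sum>m. c(m) = sin x / x = 0\<close>.
  Hence changing \<open>n\<^sup>2\<^sup>j F(2j)\<close> by an absolutely summable sequence (in particular, changing
  finitely many of the \<open>F(2j)\<close> arbitrarily) does not affect the sum. Since the part of
  \<open>n\<^sup>2\<^sup>j F(2j)\<close> coming from \<open>k > n\<close> decays geometrically, only \<open>\<Sum>k\<le>n. a(k) q\<^sup>j\<close> with
  \<open>q = (n/k)\<^sup>2 \<ge> 1\<close> remains. As \<open>\<Sum>m. c(m) / q\<^sup>m\<close> also vanishes, being \<open>sin (2\<pi>k) / (2\<pi>k)\<close>, the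
  coefficients \<open>b(i) = \<Sum>j\<le>i. q\<^sup>j c(i-j)\<close> equal \<open>- (\<Sum>m>i. c(m) / q\<^sup>m\<^sup>-\<^sup>i)\<close> and decay geometrically. For \<open>q > 1\<close>
  the recursion \<open>b(i+1) = q b(i) + c(i+1)\<close> then forces their sum to be \<open>0\<close>; for \<open>q = 1\<close> the sum is
  \<open>- (\<Sum>m. m c(m)) = - (cos x - sin x / x) / 2 = - 1/2\<close>.
\<close>

section \<open>Convolving powers with a geometrically decaying sequence\<close>

text \<open>The bound is uniform in \<open>q\<close>: the convolution is minus \<open>q ^ i\<close>
  times the tail of the vanishing series, whose terms become \<open>c m / q ^ (m - i)\<close> with
  \<open>m > i\<close>. These are at most \<open>K / 2 ^ m\<close> in absolute value, and those
  bounds add up to \<open>K / 2 ^ i\<close>.\<close>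

lemma abs_convolution_power_le:
  fixes c :: "nat \<Rightarrow> real"
  assumes c: "\<And>m. \<bar>c m\<bar> \<le> K / 2 ^ m" and q: "q \<ge> 1"
    and sums: "(\<lambda>m. c m / q ^ m) sums 0"
  shows "\<bar>\<Sum>j\<le>i. q ^ j * c (i - j)\<bar> \<le> K / 2 ^ i"
proof -
  have "(\<Sum>j\<le>i. q ^ j * c (i - j)) = (\<Sum>m\<le>i. q ^ (i - m) * c m)"
    by (rule sum.reindex_bij_witness[of _ "\<lambda>j. i - j" "\<lambda>j. i - j"]) auto
  also have "\<dots> = q ^ i * (\<Sum>m<Suc i. c m / q ^ m)"
    using q by (auto simp: sum_distrib_left lessThan_Suc_atMost power_diff intro!: sum.cong)
  also have "(\<Sum>m<Suc i. c m / q ^ m) = - (\<Sum>m. c (m + Suc i) / q ^ (m + Suc i))"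
    using suminf_minus_initial_segment[OF sums_summable[OF sums], of "Suc i"] sums_unique[OF sums]
    by linarith
  also have "q ^ i * - (\<Sum>m. c (m + Suc i) / q ^ (m + Suc i))
      = - (q ^ i * (\<Sum>m. c (m + Suc i) / q ^ (m + Suc i)))"
    by (rule mult_minus_right)
  also have "q ^ i * (\<Sum>m. c (m + Suc i) / q ^ (m + Suc i))
      = (\<Sum>m. q ^ i * (c (m + Suc i) / q ^ (m + Suc i)))"
    by (intro suminf_mult[symmetric] summable_ignore_initial_segment sums_summable[OF sums])
  finally have eq: "\<bar>\<Sum>j\<le>i. q ^ j * c (i - j)\<bar> = norm (\<Sum>m. q ^ i * (c (m + Suc i) / q ^ (m + Suc i)))"
    by simp
  have geo: "(\<lambda>m. K / 2 ^ i * (1 / 2) ^ Suc m) sums (K / 2 ^ i * 1)"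
    by (intro sums_mult power_half_series)
  have le: "norm (q ^ i * (c (m + Suc i) / q ^ (m + Suc i))) \<le> K / 2 ^ i * (1 / 2) ^ Suc m" for m
  proof -
    have "norm (q ^ i * (c (m + Suc i) / q ^ (m + Suc i))) = \<bar>c (m + Suc i)\<bar> / q ^ Suc m"
      using q by (simp add: abs_mult power_add field_simps)
    also have "\<dots> \<le> \<bar>c (m + Suc i)\<bar> / 1"
      using q one_le_power[of q "Suc m"] by (intro divide_left_mono) auto
    also have "\<dots> \<le> K / 2 ^ (m + Suc i)"
      using c[of "m + Suc i"] by simp
    finally show ?thesis
      by (simp add: power_add power_divide mult_ac)
  qed
  show ?thesis
    unfolding eq using norm_suminf_le[OF le sums_summable[OF geo]] sums_unique[OF geo]
    by simp
qed

text \<open>Summing the recursion over all \<open>i\<close> gives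
  \<open>S - b 0 = q * S - c 0\<close> for the sum \<open>S\<close> of \<open>b\<close>; as
  \<open>b 0 = c 0\<close> and \<open>q \<noteq> 1\<close>, \<open>S\<close> vanishes.\<close>

lemma convolution_power_sums_zero:
  fixes c :: "nat \<Rightarrow> real"
  assumes c: "\<And>m. \<bar>c m\<bar> \<le> K / 2 ^ m" and q: "q > 1"
    and sums: "(\<lambda>m. c m / q ^ m) sums 0" "c sums 0"
  shows "(\<lambda>i. \<Sum>j\<le>i. q ^ j * c (i - j)) sums 0"
proof -
  define b where "b i = (\<Sum>j\<le>i. q ^ j * c (i - j))" for i
  have "summable (\<lambda>i. K * (1 / 2) ^ i)"
    by (intro summable_mult summable_geometric) auto
  moreover have "norm (b i) \<le> K * (1 / 2) ^ i" for i
    using abs_convolution_power_le[OF c _ sums(1), of i] q by (simp add: b_def power_divide)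
  ultimately have b: "summable b"
    using summable_comparison_test' by blast
  have rec: "b (Suc i) = q * b i + c (Suc i)" for i
    unfolding b_def by (subst sum.atMost_Suc_shift) (simp add: sum_distrib_left mult_ac)
  have "(\<lambda>i. q * b i + c (Suc i)) sums (q * suminf b + (0 - c 0))"
    using b sums(2) by (intro sums_add sums_mult summable_sums) (auto simp: sums_Suc_iff)
  moreover have "(\<lambda>i. b (Suc i)) sums (suminf b - b 0)"
    using summable_sums[OF b] by (simp add: sums_Suc_iff)
  ultimately have "suminf b - b 0 = q * suminf b - c 0"
    unfolding rec using sums_unique2 by fastforce
  then have "suminf b * (1 - q) = 0"
    by (simp add: b_def algebra_simps)
  then show ?thesis
    using q summable_sums[OF b] by (simp add: b_def[abs_def])
qed

text \<open>Summation by parts: the first \<open>M\<close> values of \<open>b\<close> add up to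
  \<open>M * b M\<close> minus a partial sum of the first moment, and the boundary term
  \<open>M * b M\<close> tends to 0 because \<open>b\<close> decays geometrically.\<close>

lemma partial_sums_sums_minus_moment:
  fixes c :: "nat \<Rightarrow> real"
  assumes c: "\<And>m. \<bar>c m\<bar> \<le> K / 2 ^ m"
    and sums: "c sums 0" "(\<lambda>m. real m * c m) sums s"
  shows "(\<lambda>i. \<Sum>j\<le>i. c (i - j)) sums (- s)"
proof -
  define b where "b i = (\<Sum>m\<le>i. c m)" for i
  have b: "(\<Sum>j\<le>i. c (i - j)) = b i" for i
    unfolding b_def by (rule sum.reindex_bij_witness[of _ "\<lambda>j. i - j" "\<lambda>j. i - j"]) auto
  have bound: "\<bar>b i\<bar> \<le> K / 2 ^ i" for i
    using abs_convolution_power_le[OF c, of 1 i] sums(1) b by simp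
  have part: "(\<Sum>i<M. b i) = real M * b M - (\<Sum>m\<le>M. real m * c m)" for M
    by (induction M) (auto simp: b_def algebra_simps)
  have "(\<lambda>M. real M * (1 / 2) ^ M) \<longlonglongrightarrow> 0"
    by (rule powser_times_n_limit_0) auto
  then have "(\<lambda>M. K * (real M * (1 / 2) ^ M)) \<longlonglongrightarrow> 0"
    by (rule tendsto_mult_right_zero)
  moreover have "norm (real M * b M) \<le> K * (real M * (1 / 2) ^ M)" for M
    using mult_left_mono[OF bound[of M], of "real M"] by (simp add: abs_mult power_divide mult_ac)
  ultimately have "(\<lambda>M. real M * b M) \<longlonglongrightarrow> 0"
    by (rule Lim_null_comparison[OF always_eventually[OF allI], rotated])
  then have "(\<lambda>M. real M * b M - (\<Sum>m\<le>M. real m * c m)) \<longlonglongrightarrow> 0 - s"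
    by (intro tendsto_diff sums(2)[unfolded sums_def_le])
  then show ?thesis
    unfolding b sums_def part by simp
qed

section \<open>The power series of sin x / x\<close>

definition sinc_coeff :: "real \<Rightarrow> nat \<Rightarrow> real" where
  "sinc_coeff x m = (- 1) ^ m * x ^ (2 * m) / fact (2 * m + 1)"

lemma sinc_coeff_sums:
  assumes "x \<noteq> 0"
  shows "sinc_coeff x sums (sin x / x)"
  using sums_divide[OF sin_paired[of x], of x] assms
  by (simp add: sinc_coeff_def[abs_def] mult_ac)

text \<open>Multiplying the coefficient by \<open>2 * m + 1\<close> gives the term of the cosine
  series, so \<open>m\<close> times it is half the difference of the two terms.\<close>

lemma sinc_coeff_moment_sums:
  assumes "x \<noteq> 0"
  shows "(\<lambda>m. real m * sinc_coeff x m) sums ((cos x - sin x / x) / 2)"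
proof -
  have "(\<lambda>m. ((- 1) ^ m / fact (2 * m) * x ^ (2 * m) - sinc_coeff x m) / 2)
      sums ((cos x - sin x / x) / 2)"
    by (intro sums_divide sums_diff cos_paired sinc_coeff_sums assms)
  moreover have "((- 1) ^ m / fact (2 * m) * x ^ (2 * m) - sinc_coeff x m) / 2 = real m * sinc_coeff x m" for m
    by (simp add: sinc_coeff_def divide_simps) (simp add: algebra_simps)
  ultimately show ?thesis by simp
qed

lemma sinc_coeff_scale: "sinc_coeff (r * x) m = sinc_coeff x m * (r\<^sup>2) ^ m"
  by (simp add: sinc_coeff_def power_mult_distrib power_mult)

text \<open>Convergence of the series at \<open>sqrt 2 * x\<close> makes
  \<open>sinc_coeff x m * 2 ^ m\<close> a null sequence, hence bounded.\<close>

lemma sinc_coeff_geometric_bound: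
  assumes "x \<noteq> 0"
  obtains K where "\<And>m. \<bar>sinc_coeff x m\<bar> \<le> K / 2 ^ m"
proof -
  have "(\<lambda>m. sinc_coeff x m * 2 ^ m) \<longlonglongrightarrow> 0"
    using summable_LIMSEQ_zero[OF sums_summable[OF sinc_coeff_sums[of "sqrt 2 * x"]]] assms
    by (simp add: sinc_coeff_scale[of "sqrt 2" x, abs_def])
  then have "Bseq (\<lambda>m. sinc_coeff x m * 2 ^ m)"
    by (intro convergent_imp_Bseq convergentI)
  then obtain K where "\<And>m. norm (sinc_coeff x m * 2 ^ m) \<le> K"
    by (auto simp: Bseq_def)
  then show ?thesis
    by (intro that[of K]) (simp add: abs_mult field_simps)
qed

section \<open>Dirichlet series at even integers\<close>

lemma nat_powr_minus_even:
  "(of_nat (Suc k) :: complex) powr (- of_nat (2 * j)) = 1 / of_nat (Suc k) ^ (2 * j)"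
  by (simp add: powr_minus_divide powr_nat' del: of_nat_Suc of_nat_mult)

text \<open>The terms of the convergent series at \<open>s\<close> are bounded; moving the real part
  of the exponent up by at least 2 gains a factor of at most \<open>1 / k\<^sup>2\<close>.\<close>

lemma dirichlet_abs_summable:
  assumes "dirichlet_converges a s" and j: "real (2 * j) \<ge> Re s + 2"
  shows "summable (\<lambda>k. norm (a (Suc k)) / real (Suc k) ^ (2 * j))"
proof -
  obtain C where C: "\<And>k. norm (a (Suc k) * of_nat (Suc k) powr (- s)) \<le> C"
    using summable_imp_Bseq[OF assms(1)[unfolded dirichlet_converges_def]] by (auto simp: Bseq_def)
  have "norm (norm (a (Suc k)) / real (Suc k) ^ (2 * j)) \<le> C * inverse (real (Suc k) ^ 2)" for k
  proof -
    have "norm (a (Suc k)) * real (Suc k) powr (- Re s) \<le> C"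
      using C[of k] norm_powr_real_powr[of "of_nat (Suc k)" "- s"]
      by (simp add: norm_mult del: of_nat_Suc)
    moreover have "real (Suc k) powr (2 - real (2 * j)) \<le> real (Suc k) powr (- Re s)"
      using j by (intro powr_mono) auto
    ultimately have "norm (a (Suc k)) * real (Suc k) powr (2 - real (2 * j)) \<le> C"
      by (meson mult_left_mono norm_ge_zero order_trans)
    moreover have "real (Suc k) powr (2 - real (2 * j)) = real (Suc k) ^ 2 / real (Suc k) ^ (2 * j)"
      unfolding powr_diff using powr_realpow[of "real (Suc k)" "2 * j"] by simp
    ultimately have "norm (a (Suc k)) * (real (Suc k) ^ 2 / real (Suc k) ^ (2 * j)) \<le> C"
      by (simp only:)
    then have "norm (a (Suc k)) / real (Suc k) ^ (2 * j) * real (Suc k) ^ 2 \<le> C"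
      by (simp only: times_divide_eq_right times_divide_eq_left)
    then show ?thesis
      by (simp add: pos_le_divide_eq flip: divide_inverse del: of_nat_Suc)
  qed
  moreover have "summable (\<lambda>k. C * inverse (real (Suc k) ^ 2))"
    using summable_Suc_iff[THEN iffD2, OF inverse_power_summable[of 2, where 'a = real]]
    by (intro summable_mult) simp
  ultimately show ?thesis
    by (rule summable_comparison_test'[rotated])
qed

lemma dirichlet_converges_even:
  assumes "dirichlet_converges a s" and j: "real (2 * j) \<ge> Re s + 2"
  shows "dirichlet_converges a (of_nat (2 * j))"
  unfolding dirichlet_converges_def nat_powr_minus_even
  by (rule summable_norm_cancel)
     (use dirichlet_abs_summable[OF assms] in \<open>simp add: norm_divide norm_power del: of_nat_Suc\<close>)

text \<open>For \<open>j \<ge> N\<close> the difference is the part of the scaled Dirichlet series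
  with index above \<open>n\<close>, where every ratio \<open>(n / k)\<^sup>2\<close> is at most
  \<open>(n / (n + 1))\<^sup>2 < 1\<close>.\<close>

lemma dirichlet_scaled_tail_summable:
  assumes conv: "dirichlet_converges a s" and N: "real (2 * N) \<ge> Re s + 2" and n: "n > 0"
    and F: "\<And>j. j \<ge> N \<Longrightarrow> F j = dirichlet_series a (of_nat (2 * j))"
  shows "summable (\<lambda>j. norm (F j * of_nat n ^ (2 * j)
           - (\<Sum>k<n. a (Suc k) * of_real (((real n / real (Suc k))\<^sup>2) ^ j))))"
proof -
  define r where "r k = (real n / real (Suc k))\<^sup>2" for k
  \<comment> \<open>The power \<open>r ^ j\<close> is split: exponent \<open>N\<close> makes the
    weights \<open>w\<close> summable, and the remaining exponent \<open>j - N\<close> supplies the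
    geometric decay in \<open>j\<close>.\<close>
  define w where "w k = norm (a (Suc (k + n))) * r (k + n) ^ N" for k
  have r_le: "r (k + n) \<le> r n" for k
    unfolding r_def by (intro power_mono divide_left_mono) auto
  have r0: "r k \<ge> 0" for k by (simp add: r_def)
  have r1: "r n < 1"
    unfolding r_def by (intro power_less_one_iff[THEN iffD2]) auto
  have "summable (\<lambda>k. real n ^ (2 * N) * (norm (a (Suc k)) / real (Suc k) ^ (2 * N)))"
    by (intro summable_mult dirichlet_abs_summable[OF conv N])
  from summable_ignore_initial_segment[OF this, of n] have w: "summable w"
    by (simp add: w_def[abs_def] r_def power_mult power_divide mult_ac del: of_nat_Suc flip: power_mult)
  have le: "norm (F j * of_nat n ^ (2 * j) - (\<Sum>k<n. a (Suc k) * of_real (r k ^ j)))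
      \<le> suminf w * r n ^ (j - N)" if j: "j \<ge> N" for j
  proof -
    define u where "u k = a (Suc k) * of_real (r k ^ j)" for k
    have u: "u k = a (Suc k) * of_nat (Suc k) powr (- of_nat (2 * j)) * of_nat n ^ (2 * j)" for k
      unfolding u_def nat_powr_minus_even r_def by (simp add: power_mult power_divide del: of_nat_Suc)
    have "real (2 * j) \<ge> Re s + 2" using N j by linarith
    then have sm: "summable (\<lambda>k. a (Suc k) * of_nat (Suc k) powr (- of_nat (2 * j)))"
      using dirichlet_converges_even[OF conv] unfolding dirichlet_converges_def by blast
    have su: "summable u"
      unfolding u[abs_def] by (intro summable_mult2 sm)
    have "F j * of_nat n ^ (2 * j) = suminf u"
      unfolding F[OF j] dirichlet_series_def u[abs_def] by (rule suminf_mult2[OF sm])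
    then have eq: "F j * of_nat n ^ (2 * j) - (\<Sum>k<n. u k) = (\<Sum>k. u (k + n))"
      using suminf_minus_initial_segment[OF su, of n] by simp
    have "norm (u (k + n)) \<le> w k * r n ^ (j - N)" for k
    proof -
      have "norm (u (k + n)) = w k * r (k + n) ^ (j - N)"
        using j r0[of "k + n"] by (simp add: u_def w_def norm_mult norm_power flip: power_add)
      also have "\<dots> \<le> w k * r n ^ (j - N)"
        using r_le r0 by (intro mult_left_mono power_mono) (auto simp: w_def)
      finally show ?thesis .
    qed
    then have "norm (\<Sum>k. u (k + n)) \<le> (\<Sum>k. w k * r n ^ (j - N))"
      using w by (intro norm_suminf_le summable_mult2)
    then show ?thesis
      unfolding eq[unfolded u_def] using suminf_mult2[OF w] by (simp add: u_def)
  qed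
  have "summable (\<lambda>j. suminf w * r n ^ j)"
    using r0 r1 by (intro summable_mult summable_geometric) auto
  then have "summable (\<lambda>j. norm (F (j + N) * of_nat n ^ (2 * (j + N))
      - (\<Sum>k<n. a (Suc k) * of_real (r k ^ (j + N)))))"
    by (rule summable_comparison_test'[where N = 0]) (use le[of "_ + N"] in simp)
  then show ?thesis
    unfolding r_def[symmetric]
    by (subst (asm) summable_iff_shift[of "\<lambda>j. norm (F j * of_nat n ^ (2 * j)
      - (\<Sum>k<n. a (Suc k) * of_real (r k ^ j)))"])
qed

section \<open>Evaluating the convolution\<close>

lemma sinc_convolution_sums:
  assumes conv: "dirichlet_converges a s" and N: "real (2 * N) \<ge> Re s + 2" and n: "n > 0"
    and F: "\<And>j. j \<ge> N \<Longrightarrow> F j = dirichlet_series a (of_nat (2 * j))"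
  defines "x \<equiv> 2 * pi * real n"
  shows "(\<lambda>i. \<Sum>j\<le>i. F j * of_nat n ^ (2 * j) * of_real (sinc_coeff x (i - j))) sums (- a n / 2)"
proof -
  define c where "c = sinc_coeff x"
  define q where "q k = (real n / real (Suc k))\<^sup>2" for k
  define e where "e j = F j * of_nat n ^ (2 * j) - (\<Sum>k<n. a (Suc k) * of_real (q k ^ j))" for j
  have x: "x \<noteq> 0" using n by (simp add: x_def)
  have sin0: "sin (2 * pi * real k) = 0" for k
    using sin_2npi[of k] by (simp only: mult_ac)
  have cos1: "cos (2 * pi * real k) = 1" for k
    using cos_2npi[of k] by (simp only: mult_ac)
  obtain K where K: "\<And>m. \<bar>c m\<bar> \<le> K / 2 ^ m"
    using sinc_coeff_geometric_bound[OF x] unfolding c_def by blast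
  have c0: "c sums 0"
    using sinc_coeff_sums[OF x] sin0[of n] by (simp add: c_def x_def)
  have "summable (\<lambda>m. K * (1 / 2) ^ m)"
    by (intro summable_mult summable_geometric) auto
  then have nc: "summable (\<lambda>m. norm (complex_of_real (c m)))"
    by (rule summable_comparison_test'[where N = 0]) (use K in \<open>auto simp: power_divide\<close>)
  have ne: "summable (\<lambda>j. norm (e j))"
    using dirichlet_scaled_tail_summable[OF conv N n F] by (simp add: e_def q_def)
  have "(\<Sum>m. complex_of_real (c m)) = 0"
    using sums_of_real[OF c0, where 'a = complex] by (simp add: sums_iff)
  \<comment> \<open>A Cauchy product of absolutely convergent series, one of which has sum
    0.\<close>
  then have E: "(\<lambda>i. \<Sum>j\<le>i. e j * of_real (c (i - j))) sums 0"
    using Cauchy_product_sums[OF ne nc] by simp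
  \<comment> \<open>Index \<open>k\<close> stands for the integer \<open>Suc k\<close>, so that
    \<open>q k = 1\<close> exactly when \<open>Suc k = n\<close>; this single case produces
    \<open>a n\<close>.\<close>
  have B: "(\<lambda>i. \<Sum>j\<le>i. q k ^ j * c (i - j)) sums (if Suc k = n then - 1 / 2 else 0)" if k: "k < n" for k
  proof (cases "Suc k = n")
    case True
    then have "q k = 1" using n by (simp add: q_def)
    moreover have "(\<lambda>m. real m * c m) sums (1 / 2)"
      using sinc_coeff_moment_sums[OF x] sin0[of n] cos1[of n] by (simp add: c_def x_def)
    ultimately show ?thesis
      using partial_sums_sums_minus_moment[OF K c0] True by auto
  next
    case False
    have "q k > 1"
      unfolding q_def using k False by (intro one_less_power) auto
    moreover have "(\<lambda>m. c m / q k ^ m) sums 0"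
    proof -
      \<comment> \<open>Dividing by \<open>q k ^ m\<close> rescales the argument from
        \<open>2 * pi * n\<close> to \<open>2 * pi * Suc k\<close>, which is again a zero of the
        sine.\<close>
      have "sinc_coeff (2 * pi * real (Suc k)) m = c m / q k ^ m" for m
        using sinc_coeff_scale[of "real (Suc k) / real n" x m] n
        by (simp add: c_def x_def q_def power_divide mult.commute[of _ "real (Suc k)"] del: of_nat_Suc)
      then show ?thesis
        using sinc_coeff_sums[of "2 * pi * real (Suc k)"] sin0[of "Suc k"]
        by (simp add: sums_def del: of_nat_Suc)
    qed
    ultimately show ?thesis
      using convolution_power_sums_zero[OF K _ _ c0] False by simp
  qed
  have "(\<lambda>i. (\<Sum>j\<le>i. e j * of_real (c (i - j)))
        + (\<Sum>k<n. a (Suc k) * of_real (\<Sum>j\<le>i. q k ^ j * c (i - j))))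
      sums (0 + (\<Sum>k<n. a (Suc k) * of_real (if Suc k = n then - 1 / 2 else 0)))"
    by (intro sums_add E sums_sum sums_mult sums_of_real B) auto
  moreover have "(\<Sum>k<n. a (Suc k) * of_real (if Suc k = n then - 1 / 2 else 0)) = - a n / 2"
  proof -
    have "(\<Sum>k<n. a (Suc k) * of_real (if Suc k = n then - 1 / 2 else 0))
        = (\<Sum>k<n. if k = n - 1 then - a n / 2 else 0)"
      using n by (intro sum.cong) auto
    then show ?thesis using n by simp
  qed
  moreover have "(\<Sum>j\<le>i. e j * of_real (c (i - j)))
        + (\<Sum>k<n. a (Suc k) * of_real (\<Sum>j\<le>i. q k ^ j * c (i - j)))
      = (\<Sum>j\<le>i. F j * of_nat n ^ (2 * j) * of_real (c (i - j)))" for i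
  proof -
    have "(\<Sum>k<n. a (Suc k) * of_real (\<Sum>j\<le>i. q k ^ j * c (i - j)))
        = (\<Sum>j\<le>i. (\<Sum>k<n. a (Suc k) * of_real (q k ^ j)) * of_real (c (i - j)))"
      unfolding of_real_sum sum_distrib_left sum_distrib_right
      by (subst sum.swap) (simp add: mult_ac)
    then show ?thesis
      by (simp add: e_def algebra_simps flip: sum.distrib)
  qed
  ultimately show ?thesis by (simp add: c_def)
qed

section \<open>Reduction of the stated series to the convolution\<close>

theorem theorem2:
  fixes a :: "nat \<Rightarrow> complex"
    and F :: "nat \<Rightarrow> complex"
    and omitted :: "nat set"
  assumes "\<exists>s. dirichlet_converges a s"
    and "\<And>j. j \<in> omitted \<Longrightarrow> \<not> dirichlet_converges a (of_nat (2 * j))"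
    and "\<And>j. dirichlet_converges a (of_nat (2 * j)) \<Longrightarrow> F j = dirichlet_series a (of_nat (2 * j))"
    and "\<And>j. \<not> dirichlet_converges a (of_nat (2 * j)) \<Longrightarrow> j \<notin> omitted \<Longrightarrow>
           \<exists>D G. analytic_continuation a D G \<and> of_nat (2 * j) \<in> D \<and> F j = G (of_nat (2 * j))"
  shows "finite {j :: nat. \<not> dirichlet_converges a (of_nat (2 * j))} \<and>
    (\<forall>n>0.
      summable (\<lambda>i. (- 1) ^ i * (2 * of_real pi * of_nat n) ^ (2 * i) *
        (\<Sum>j\<in>{0..i} - omitted.
          (- 1) ^ j * (2 * of_real pi) powi (- 2 * int j) * F j / fact (2 * i + 1 - 2 * j)) :: complex) \<and>
      a n = - 2 * (\<Sum>i. (- 1) ^ i * (2 * of_real pi * of_nat n) ^ (2 * i) *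
        (\<Sum>j\<in>{0..i} - omitted.
          (- 1) ^ j * (2 * of_real pi) powi (- 2 * int j) * F j / fact (2 * i + 1 - 2 * j))))"
proof -
  obtain s where conv: "dirichlet_converges a s" using assms(1) by blast
  \<comment> \<open>Rounding up \<open>Re s + 2\<close> itself, rather than its half, suffices since
    \<open>2 * j \<ge> j\<close>.\<close>
  define N where "N = nat \<lceil>Re s + 2\<rceil>"
  have N: "real (2 * j) \<ge> Re s + 2" if "j \<ge> N" for j
    using that unfolding N_def by linarith
  have convN: "dirichlet_converges a (of_nat (2 * j))" if "j \<ge> N" for j
    using dirichlet_converges_even[OF conv N[OF that]] .
  have fin: "finite {j :: nat. \<not> dirichlet_converges a (of_nat (2 * j))}"
    by (rule finite_subset[of _ "{..<N}"]) (use convN in \<open>auto simp: not_le[symmetric]\<close>)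
  \<comment> \<open>Omitting a term amounts to the value 0, so the inner sum can run over all
    \<open>j \<le> i\<close>. From \<open>N\<close> on the series converges and nothing is
    omitted.\<close>
  define F' where "F' j = (if j \<in> omitted then 0 else F j)" for j
  have F': "F' j = dirichlet_series a (of_nat (2 * j))" if "j \<ge> N" for j
    using assms(2,3) convN[OF that] by (auto simp: F'_def)
  have "(\<lambda>i. (- 1) ^ i * (2 * of_real pi * of_nat n) ^ (2 * i) *
        (\<Sum>j\<in>{0..i} - omitted.
          (- 1) ^ j * (2 * of_real pi) powi (- 2 * int j) * F j / fact (2 * i + 1 - 2 * j)))
      sums (- a n / 2)" if n: "n > 0" for n
  proof -
    have term_eq: "(- 1) ^ i * (2 * of_real pi * of_nat n) ^ (2 * i) *
        ((- 1) ^ j * (2 * of_real pi) powi (- 2 * int j) * F j / fact (2 * i + 1 - 2 * j))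
      = F j * of_nat n ^ (2 * j) * complex_of_real (sinc_coeff (2 * pi * real n) (i - j))"
      if "j \<le> i" for i j
    proof -
      \<comment> \<open>With \<open>i = j + m\<close> the factors \<open>(2 * pi) ^ (2 * j)\<close>
        cancel, and the signs combine to \<open>(- 1) ^ m\<close>; what is left is
        \<open>n ^ (2 * j)\<close> times the coefficient of index \<open>m\<close>.\<close>
      obtain m where i: "i = j + m" using \<open>j \<le> i\<close> le_Suc_ex by blast
      have "(2 * complex_of_real pi) powi (- 2 * int j) = inverse ((2 * of_real pi) ^ (2 * j))"
        using power_int_minus[of "2 * complex_of_real pi" "int (2 * j)"]
        by (simp only: power_int_of_nat) simp
      moreover have "2 * i + 1 - 2 * j = 2 * m + 1" "i - j = m" by (simp_all add: i)
      moreover have "(- 1 :: complex) ^ i * (- 1) ^ j = (- 1) ^ m"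
        by (simp add: i power_add mult.assoc flip: power_mult_distrib)
      ultimately show ?thesis
        by (simp add: sinc_coeff_def i power_add power_mult_distrib field_simps del: fact_Suc)
    qed
    have "(- 1) ^ i * (2 * of_real pi * of_nat n) ^ (2 * i) *
        (\<Sum>j\<in>{0..i} - omitted.
          (- 1) ^ j * (2 * of_real pi) powi (- 2 * int j) * F j / fact (2 * i + 1 - 2 * j))
      = (\<Sum>j\<le>i. F' j * of_nat n ^ (2 * j) * of_real (sinc_coeff (2 * pi * real n) (i - j)))" for i
      unfolding sum_distrib_left
    proof (rule sum.mono_neutral_cong_left)
      fix j assume "j \<in> {0..i} - omitted"
      then show "(- 1) ^ i * (2 * of_real pi * of_nat n) ^ (2 * i) *
          ((- 1) ^ j * (2 * of_real pi) powi (- 2 * int j) * F j / fact (2 * i + 1 - 2 * j))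
        = F' j * of_nat n ^ (2 * j) * complex_of_real (sinc_coeff (2 * pi * real n) (i - j))"
        by (subst term_eq) (auto simp: F'_def)
    qed (auto simp: F'_def)
    then show ?thesis
      using sinc_convolution_sums[OF conv N[OF order_refl] n F'] by simp
  qed
  then show ?thesis
    using fin by (auto simp: sums_iff)
qed

end
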